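(* Let $n\ge 1$ and let $S$ be a set of $n$ holes in $T(n)$, i.e. a set of $n$ upward unit triangles of $T(n)$ which are removed. The triangle $T(n)$ with holes at $S$ can be tiled with unit rhombi if and only if the locations of the holes constitute a basis of the matroid $\mathcal{T}_{n,3}$; that is, if and only if every $T(k)$ in $T(n)$ contains at most $k$ holes of $S$, for all $k\le n$.
   Context: $T(n)$ is an equilateral triangle of side length $n$, cut into $n^2$ unit equilateral triangles, of which $n(n+1)/2$ point upward (in the same direction as $T(n)$) and $n(n-1)/2$ point downward. A unit rhombus (with angles $60^\circ$ and $120^\circ$) is the union of one upward and one downward unit triangle sharing an edge. A tiling of the holey triangle covers every unit triangle not in $S$ exactly once by such rhombi, none of which uses a triangle of $S$. A $T(k)$ in $T(n)$ is an upward-pointing triangle of side length $k$ that is a union of unit triangles of the subdivision. Upward unit triangles are identified with the points of $T_{n,3}=\{x\in\mathbb{Z}_{\ge0}^3: x_1+x_2+x_3=n-1\}$ in the natural way (downward triangles then correspond to $y\in\mathbb{Z}_{\ge 0}^3$ with $y_1+y_2+y_3=n-2$, the downward triangle $y$ being adjacent to the upward triangles $y+e_1,y+e_2,y+e_3$, where $e_i$ are the standard basis vectors). Under this identification the upward triangles in a $T(k)$ form a simplex of size $k$ in $T_{n,3}$: a set $\{x\in T_{n,3}: x_i\ge a_i\ \forall i\}$ with $a_i\in\mathbb{Z}_{\ge 0}$ and $a_1+a_2+a_3=n-k$. $\mathcal{T}_{n,3}$ is the matroid on $T_{n,3}$ whose independent sets are the subsets $I$ such that every simplex of size $k$ contains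 at most $k$ points of $I$, for all $1\le k\le n$. *)

theory Defs
  imports Main
begin

section \<open>Matroids\<close>

locale matroid =
  fixes E :: "'a set" and indep :: "'a set \<Rightarrow> bool"
  assumes finite_ground: "finite E"
    and indep_subset_ground: "indep I \<Longrightarrow> I \<subseteq> E"
    and indep_empty: "indep {}"
    and indep_mono: "indep J \<Longrightarrow> I \<subseteq> J \<Longrightarrow> indep I"
    and augment: "indep I \<Longrightarrow> indep J \<Longrightarrow> card I < card J \<Longrightarrow> \<exists>x\<in>J - I. indep (insert x I)"
begin

definition basis :: "'a set \<Rightarrow> bool" where
  "basis B \<longleftrightarrow> indep B \<and> (\<forall>B'. indep B' \<and> B \<subseteq> B' \<longrightarrow> B' = B)"

end


section \<open>The matroid \<open>T\<^sub>n\<^sub>,\<^sub>3\<close>\<close>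

type_synonym point = "nat \<times> nat \<times> nat"

fun coord_sum :: "point \<Rightarrow> nat" where
  "coord_sum (x1, x2, x3) = x1 + x2 + x3"

fun below :: "point \<Rightarrow> point \<Rightarrow> bool" where
  "below (a1, a2, a3) (x1, x2, x3) \<longleftrightarrow> a1 \<le> x1 \<and> a2 \<le> x2 \<and> a3 \<le> x3"

text \<open>The coordinate sum is \<open>n - 1\<close>; written additively to avoid truncated subtraction.\<close>

definition points :: "nat \<Rightarrow> point set" where
  "points n = {x. coord_sum x + 1 = n}"

definition is_simplex :: "nat \<Rightarrow> nat \<Rightarrow> point set \<Rightarrow> bool" where
  "is_simplex n k X \<longleftrightarrow> (\<exists>a. coord_sum a + k = n \<and> X = {x \<in> points n. below a x})"

definition indep :: "nat \<Rightarrow> point set \<Rightarrow> bool" where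
  "indep n I \<longleftrightarrow> I \<subseteq> points n \<and>
     (\<forall>k X. 1 \<le> k \<and> k \<le> n \<and> is_simplex n k X \<longrightarrow> card (X \<inter> I) \<le> k)"


section \<open>Unit triangles and rhombus tilings\<close>

text \<open>
  The unit triangles of \<open>T(n)\<close> are \<open>Up x\<close> with \<open>x1 + x2 + x3 = n - 1\<close> and \<open>Down y\<close> with
  \<open>y1 + y2 + y3 = n - 2\<close>, where \<open>Down y\<close> shares its three edges with \<open>Up (y + e\<^sub>i)\<close>.
\<close>

datatype unit_triangle = Up point | Down point

definition unit_triangles :: "nat \<Rightarrow> unit_triangle set" where
  "unit_triangles n = Up ` points n \<union> Down ` {y. coord_sum y + 2 = n}"

definition upward_triangles :: "nat \<Rightarrow> unit_triangle set" where
  "upward_triangles n = Up ` points n"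

fun adjacent :: "point \<Rightarrow> point \<Rightarrow> bool" where
  "adjacent x (y1, y2, y3) \<longleftrightarrow>
     x = (y1 + 1, y2, y3) \<or> x = (y1, y2 + 1, y3) \<or> x = (y1, y2, y3 + 1)"

definition rhombi :: "nat \<Rightarrow> unit_triangle set set" where
  "rhombi n = {{Up x, Down y} | x y.
     Up x \<in> unit_triangles n \<and> Down y \<in> unit_triangles n \<and> adjacent x y}"

definition is_tiling :: "nat \<Rightarrow> unit_triangle set \<Rightarrow> unit_triangle set set \<Rightarrow> bool" where
  "is_tiling n S R \<longleftrightarrow> R \<subseteq> rhombi n \<and>
     (\<forall>r\<in>R. r \<inter> S = {}) \<and>
     (\<forall>t \<in> unit_triangles n - S. \<exists>!r. r \<in> R \<and> t \<in> r)"

definition can_be_tiled :: "nat \<Rightarrow> unit_triangle set \<Rightarrow> bool" where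
  "can_be_tiled n S \<longleftrightarrow> (\<exists>R. is_tiling n S R)"

text \<open>
  A \<open>T(k)\<close> in \<open>T(n)\<close>, as the set of all its unit triangles. Note that \<open>Down y\<close> lies in it iff its
  three neighbours \<open>Up (y + e\<^sub>i)\<close> do, which amounts to \<open>y\<^sub>i \<ge> a\<^sub>i\<close> for all \<open>i\<close>.
\<close>

definition is_subtriangle :: "nat \<Rightarrow> nat \<Rightarrow> unit_triangle set \<Rightarrow> bool" where
  "is_subtriangle n k T \<longleftrightarrow> (\<exists>a. coord_sum a + k = n \<and>
     T = {t \<in> unit_triangles n. case t of Up x \<Rightarrow> below a x | Down y \<Rightarrow> below a y})"

definition locations :: "unit_triangle set \<Rightarrow> point set" where
  "locations S = {x. Up x \<in> S}"


section \<open>The independent sets do form a matroid\<close>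

lemma finite_points: "finite (points n)"
proof -
  have "points n \<subseteq> {..n} \<times> {..n} \<times> {..n}"
    by (auto simp: points_def)
  then show ?thesis by (rule finite_subset) auto
qed

definition simplex_at :: "nat \<Rightarrow> point \<Rightarrow> point set" where
  "simplex_at n a = {x \<in> points n. below a x}"

lemma indep_alt:
  "indep n I \<longleftrightarrow> I \<subseteq> points n \<and>
     (\<forall>a. coord_sum a < n \<longrightarrow> card (simplex_at n a \<inter> I) \<le> n - coord_sum a)"
proof -
  have "(\<forall>k X. 1 \<le> k \<and> k \<le> n \<and> is_simplex n k X \<longrightarrow> card (X \<inter> I) \<le> k) \<longleftrightarrow>
        (\<forall>a. coord_sum a < n \<longrightarrow> card (simplex_at n a \<inter> I) \<le> n - coord_sum a)" (is "?L \<longleftrightarrow> ?R")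
  proof
    assume L: ?L
    show ?R
    proof (intro allI impI)
      fix a assume a: "coord_sum a < n"
      then have "is_simplex n (n - coord_sum a) (simplex_at n a)"
        unfolding is_simplex_def simplex_at_def by (intro exI[of _ a]) simp
      moreover have "1 \<le> n - coord_sum a" "n - coord_sum a \<le> n" using a by simp_all
      ultimately show "card (simplex_at n a \<inter> I) \<le> n - coord_sum a" using L by blast
    qed
  next
    assume R: ?R
    show ?L
    proof (intro allI impI, elim conjE)
      fix k X assume k: "1 \<le> k" and X: "is_simplex n k X"
      then obtain a where a: "coord_sum a + k = n" "X = simplex_at n a"
        unfolding is_simplex_def simplex_at_def by blast
      then have "card (X \<inter> I) \<le> n - coord_sum a" using R[rule_format, of a] k by simp
      then show "card (X \<inter> I) \<le> k" using a by simp
    qed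
  qed
  then show ?thesis unfolding indep_def by simp
qed

lemma indep_simplex:
  "indep n I \<Longrightarrow> coord_sum a < n \<Longrightarrow> card (simplex_at n a \<inter> I) \<le> n - coord_sum a"
  unfolding indep_alt by blast

lemma below_refl: "below x x"
  by (cases x) auto

fun pjoin :: "point \<Rightarrow> point \<Rightarrow> point" where
  "pjoin (a1, a2, a3) (b1, b2, b3) = (max a1 b1, max a2 b2, max a3 b3)"

fun pmeet :: "point \<Rightarrow> point \<Rightarrow> point" where
  "pmeet (a1, a2, a3) (b1, b2, b3) = (min a1 b1, min a2 b2, min a3 b3)"

lemma pjoin_pmeet_sum:
  "coord_sum (pjoin a b) + coord_sum (pmeet a b) = coord_sum a + coord_sum b"
  by (cases a; cases b) (simp add: max_def min_def)

lemma simplex_at_Int: "simplex_at n a \<inter> simplex_at n b = simplex_at n (pjoin a b)"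
  by (cases a; cases b) (auto simp: simplex_at_def)

lemma simplex_at_Un: "simplex_at n a \<union> simplex_at n b \<subseteq> simplex_at n (pmeet a b)"
  by (cases a; cases b) (auto simp: simplex_at_def)

lemma below_coord_sum: "below a x \<Longrightarrow> coord_sum a \<le> coord_sum x"
  by (cases a; cases x) auto

lemma below_coord_sum_eq: "below a x \<Longrightarrow> coord_sum a = coord_sum x \<Longrightarrow> a = x"
  by (cases a; cases x) auto

lemma simplex_at_nonempty: "x \<in> simplex_at n a \<Longrightarrow> coord_sum a < n"
  using below_coord_sum[of a x] by (auto simp: simplex_at_def points_def)

lemma pmeet_eq_left: "coord_sum (pmeet a b) \<ge> coord_sum a \<Longrightarrow> pmeet a b = a"
  by (cases a; cases b) (auto simp: min_def split: if_splits)

lemma pmeet_commute: "pmeet a b = pmeet b a"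
  by (cases a; cases b) (auto simp: min.commute)

lemma tight_meet:
  assumes I: "indep n I"
    and a: "card (simplex_at n a \<inter> I) = n - coord_sum a"
    and b: "card (simplex_at n b \<inter> I) = n - coord_sum b"
    and x: "x \<in> simplex_at n a" "x \<in> simplex_at n b"
  shows "card (simplex_at n (pmeet a b) \<inter> I) = n - coord_sum (pmeet a b)"
proof -
  let ?A = "simplex_at n a \<inter> I" and ?B = "simplex_at n b \<inter> I"
  have fin: "finite I"
    using I finite_points finite_subset by (auto simp: indep_def)
  have j: "coord_sum (pjoin a b) < n" and m: "coord_sum (pmeet a b) < n"
    using x simplex_at_Int[of n a b] simplex_at_Un[of n a b]
    by (blast intro: simplex_at_nonempty)+
  have ab: "coord_sum a < n" "coord_sum b < n"
    using x by (blast intro: simplex_at_nonempty)+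
  have "card (?A \<union> ?B) + card (?A \<inter> ?B) = card ?A + card ?B"
    using fin by (intro card_Un_Int[symmetric]) auto
  moreover have "card (?A \<inter> ?B) = card (simplex_at n (pjoin a b) \<inter> I)"
    using simplex_at_Int[of n a b] by (intro arg_cong[where f = card]) blast
  moreover have "card (?A \<union> ?B) \<le> card (simplex_at n (pmeet a b) \<inter> I)"
    using fin simplex_at_Un[of n a b] by (intro card_mono) auto
  moreover have "card (simplex_at n (pjoin a b) \<inter> I) \<le> n - coord_sum (pjoin a b)"
    "card (simplex_at n (pmeet a b) \<inter> I) \<le> n - coord_sum (pmeet a b)"
    using indep_simplex[OF I j] indep_simplex[OF I m] by blast+
  ultimately show ?thesis
    using pjoin_pmeet_sum[of a b] a b j m ab by linarith
qed

lemma indep_augment: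
  assumes I: "indep n I" and J: "indep n J" and less: "card I < card J"
  shows "\<exists>x\<in>J - I. indep n (insert x I)"
proof (rule ccontr)
  assume contra: "\<not> (\<exists>x\<in>J - I. indep n (insert x I))"
  define tight where
    "tight a \<longleftrightarrow> coord_sum a < n \<and> card (simplex_at n a \<inter> I) = n - coord_sum a" for a
  have IP: "I \<subseteq> points n" and JP: "J \<subseteq> points n"
    using I J by (auto simp: indep_def)
  have finI: "finite I" and finJ: "finite J"
    using IP JP finite_points finite_subset by blast+
  have cover: "\<exists>a. tight a \<and> x \<in> simplex_at n a" if x: "x \<in> J" for x
  proof (cases "x \<in> I")
    case True
    have "simplex_at n x = {x}"
      using x JP below_coord_sum_eq[of x]
      by (fastforce simp: simplex_at_def points_def below_refl)
    moreover have "coord_sum x + 1 = n"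
      using x JP by (auto simp: points_def)
    ultimately have "tight x" "x \<in> simplex_at n x"
      using True by (auto simp: tight_def)
    then show ?thesis by blast
  next
    case False
    then have "\<not> indep n (insert x I)" using contra x by blast
    then obtain a where a: "coord_sum a < n"
        "\<not> card (simplex_at n a \<inter> insert x I) \<le> n - coord_sum a"
      using x IP JP unfolding indep_alt by blast
    have le: "card (simplex_at n a \<inter> I) \<le> n - coord_sum a"
      using indep_simplex[OF I a(1)] .
    have xa: "x \<in> simplex_at n a"
    proof (rule ccontr)
      assume "x \<notin> simplex_at n a"
      then have "simplex_at n a \<inter> insert x I = simplex_at n a \<inter> I" by blast
      then show False using le a by simp
    qed
    then have "simplex_at n a \<inter> insert x I = insert x (simplex_at n a \<inter> I)" by blast
    then have "card (simplex_at n a \<inter> insert x I) = Suc (card (simplex_at n a \<inter> I))"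
      using False finI by simp
    then have "tight a" using a le by (auto simp: tight_def)
    then show ?thesis using xa by blast
  qed
  define best where
    "best x = (ARG_MIN coord_sum a. tight a \<and> x \<in> simplex_at n a)" for x
  have best: "tight (best x)" "x \<in> simplex_at n (best x)" if x: "x \<in> J" for x
  proof -
    obtain a where "tight a \<and> x \<in> simplex_at n a" using cover[OF x] by blast
    from arg_min_natI[where P = "\<lambda>a. tight a \<and> x \<in> simplex_at n a" and m = coord_sum, OF this]
    show "tight (best x)" "x \<in> simplex_at n (best x)" by (auto simp: best_def)
  qed
  have best_le: "coord_sum (best x) \<le> coord_sum a" if "tight a" "x \<in> simplex_at n a" for x a
    unfolding best_def
    using arg_min_nat_le[where P = "\<lambda>a. tight a \<and> x \<in> simplex_at n a" and m = coord_sum] that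
    by blast
  have same: "best x = best y"
    if x: "x \<in> J" and y: "y \<in> J" and z: "z \<in> simplex_at n (best x)" "z \<in> simplex_at n (best y)"
    for x y z
  proof -
    let ?c = "pmeet (best x) (best y)"
    have zc: "z \<in> simplex_at n ?c" "x \<in> simplex_at n ?c" "y \<in> simplex_at n ?c"
      using simplex_at_Un[of n "best x" "best y"] z best(2)[OF x] best(2)[OF y] by blast+
    have "tight ?c"
      using tight_meet[OF I _ _ z] best(1)[OF x] best(1)[OF y] simplex_at_nonempty[OF zc(1)]
      by (simp add: tight_def)
    then have "coord_sum (best x) \<le> coord_sum ?c" "coord_sum (best y) \<le> coord_sum ?c"
      using best_le zc by blast+
    then have "?c = best x" "pmeet (best y) (best x) = best y"
      using pmeet_eq_left[of "best x" "best y"] pmeet_eq_left[of "best y" "best x"]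
      by (simp_all add: pmeet_commute[of "best y" "best x"])
    then have "?c = best x" "?c = best y"
      using pmeet_commute[of "best x" "best y"] by simp_all
    then show ?thesis by simp
  qed
  define A where "A = best ` J"
  have finA: "finite A" using finJ by (simp add: A_def)
  have disj: "simplex_at n a \<inter> simplex_at n b = {}" if "a \<in> A" "b \<in> A" "a \<noteq> b" for a b
    using that same by (auto simp: A_def)
  have "card J \<le> card (\<Union>a\<in>A. simplex_at n a \<inter> J)"
    using finJ finA best(2) by (intro card_mono) (auto simp: A_def)
  also have "\<dots> \<le> (\<Sum>a\<in>A. card (simplex_at n a \<inter> J))"
    by (rule card_UN_le[OF finA])
  also have "\<dots> \<le> (\<Sum>a\<in>A. card (simplex_at n a \<inter> I))"
  proof (rule sum_mono)
    fix a assume "a \<in> A"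
    then have "tight a" using best(1) by (auto simp: A_def)
    then show "card (simplex_at n a \<inter> J) \<le> card (simplex_at n a \<inter> I)"
      using indep_simplex[OF J, of a] by (auto simp: tight_def)
  qed
  also have "\<dots> = card (\<Union>a\<in>A. simplex_at n a \<inter> I)"
  proof (rule card_UN_disjoint[symmetric])
    show "finite A" by (rule finA)
    show "\<forall>a\<in>A. finite (simplex_at n a \<inter> I)" using finI by blast
    show "\<forall>a\<in>A. \<forall>b\<in>A. a \<noteq> b \<longrightarrow> (simplex_at n a \<inter> I) \<inter> (simplex_at n b \<inter> I) = {}"
      using disj by blast
  qed
  also have "\<dots> \<le> card I"
    using finI by (intro card_mono) auto
  finally show False using less by simp
qed

lemma matroid_points: "matroid (points n) (indep n)"
proof
  show "finite (points n)" by (rule finite_points)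
  show "I \<subseteq> points n" if "indep n I" for I
    using that by (simp add: indep_def)
  show "indep n {}" by (simp add: indep_def)
  show "indep n I" if J: "indep n J" and sub: "I \<subseteq> J" for I J
  proof -
    have "finite J" using J finite_points finite_subset by (auto simp: indep_def)
    then have "card (X \<inter> I) \<le> card (X \<inter> J)" for X
      using sub by (intro card_mono) auto
    then show ?thesis
      using J sub unfolding indep_def by (meson order_trans)
  qed
  show "\<exists>x\<in>J - I. indep n (insert x I)" if "indep n I" "indep n J" "card I < card J" for I J
    using indep_augment[OF that] .
qed

end

theory Submission
  imports Defs
begin

text \<open>
  A tiling is the same as a matching of the downward triangles into the upward triangles outside
  \<open>S\<close>: it is perfect because \<open>T(n)\<close> has exactly \<open>n\<close> more upward than downward triangles. The same
  count inside a \<open>T(k)\<close> shows that a tileable triangle has at most \<open>k\<close> holes in every \<open>T(k)\<close>.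

  Conversely, Hall's condition follows from the bound: a set \<open>N\<close> of upward triangles that contains
  all the neighbours of \<open>d\<close> downward triangles contains at most \<open>|N| - d\<close> holes. If \<open>N\<close> has exactly
  two of the three neighbours of some downward triangle, adding the third one to \<open>N\<close> only makes the
  bound stronger. If this never happens, then any triangle \<open>T(k)\<close> inside \<open>N\<close> that touches a point of
  \<open>N\<close> outside it spreads to a \<open>T(k+1)\<close> inside \<open>N\<close>. Hence \<open>N\<close> is a union of mutually separated
  triangles \<open>T(k)\<close>, and each of these has at most \<open>k\<close> holes, which is its excess of upward over
  downward triangles.
\<close>

section \<open>Hall's marriage theorem\<close>

text \<open>Induction on \<open>card I\<close>. If a nonempty proper \<open>J\<close> attains
  equality, match \<open>J\<close> first and \<open>I - J\<close> outside the neighbourhood of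
  \<open>J\<close>. If none does, every nonempty proper subset has a surplus, so one index may be
  matched arbitrarily.\<close>

lemma hall_marriage:
  fixes A :: "'i \<Rightarrow> 'a set"
  assumes "finite I" and "\<And>i. i \<in> I \<Longrightarrow> finite (A i)"
    and "\<And>J. J \<subseteq> I \<Longrightarrow> card J \<le> card (\<Union>i\<in>J. A i)"
  shows "\<exists>f. inj_on f I \<and> (\<forall>i\<in>I. f i \<in> A i)"
  using assms
proof (induction "card I" arbitrary: I A rule: less_induct)
  case less
  note fin = less.prems(1,2) and hall = less.prems(3)
  have finU: "finite (\<Union>i\<in>J. A i)" if "J \<subseteq> I" for J
    using that fin by (meson finite_UN finite_subset subsetD)
  show ?case
  proof (cases "\<exists>J. J \<subset> I \<and> J \<noteq> {} \<and> card (\<Union>i\<in>J. A i) = card J")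
    case True
    then obtain J where J: "J \<subset> I" "J \<noteq> {}" and crit: "card (\<Union>i\<in>J. A i) = card J" by blast
    let ?U = "\<Union>i\<in>J. A i"
    have finJ: "finite J" using J fin finite_subset by blast
    have "\<exists>f. inj_on f J \<and> (\<forall>i\<in>J. f i \<in> A i)"
    proof (rule less.hyps)
      show "card J < card I" using J fin by (simp add: psubset_card_mono)
    qed (use J fin finJ hall in \<open>auto intro: finite_subset\<close>)
    then obtain f where f: "inj_on f J" "\<forall>i\<in>J. f i \<in> A i" by blast
    have "\<exists>g. inj_on g (I - J) \<and> (\<forall>i\<in>I - J. g i \<in> A i - ?U)"
    proof (rule less.hyps)
      show "card (I - J) < card I"
        using J fin by (intro psubset_card_mono) auto
      \<comment> \<open>Hall's condition for \<open>J \<union> K\<close> yields the one for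
        \<open>K\<close> outside \<open>?U\<close>, since \<open>?U\<close> has exactly
        \<open>card J\<close> elements.\<close>
      fix K assume K: "K \<subseteq> I - J"
      have finK: "finite K" using K fin finite_subset by blast
      have "card J + card K = card (J \<union> K)"
        using K finJ finK by (intro card_Un_disjoint[symmetric]) auto
      also have "\<dots> \<le> card (\<Union>i\<in>J \<union> K. A i)"
        using K J by (intro hall) auto
      also have "(\<Union>i\<in>J \<union> K. A i) = ?U \<union> (\<Union>i\<in>K. A i - ?U)" by auto
      also have "card \<dots> \<le> card ?U + card (\<Union>i\<in>K. A i - ?U)" by (rule card_Un_le)
      finally show "card K \<le> card (\<Union>i\<in>K. A i - ?U)" using crit by simp
    qed (use fin in auto)
    then obtain g where g: "inj_on g (I - J)" "\<forall>i\<in>I - J. g i \<in> A i - ?U" by blast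
    let ?h = "\<lambda>i. if i \<in> J then f i else g i"
    have "inj_on ?h I"
    proof (rule inj_onI)
      fix i j assume ij: "i \<in> I" "j \<in> I" "?h i = ?h j"
      have sep: "f i' \<noteq> g j'" if "i' \<in> J" "j' \<in> I - J" for i' j'
        using that f(2) g(2) by fastforce
      show "i = j"
      proof (cases "i \<in> J"; cases "j \<in> J")
        assume "i \<in> J" "j \<in> J"
        then show ?thesis using ij f(1) by (auto dest: inj_onD)
      next
        assume "i \<notin> J" "j \<notin> J"
        then show ?thesis using ij g(1) by (auto dest: inj_onD)
      qed (use ij sep[of i j] sep[of j i] in auto)
    qed
    moreover have "\<forall>i\<in>I. ?h i \<in> A i" using f g by auto
    ultimately show ?thesis by blast
  next
    case False
    show ?thesis
    proof (cases "I = {}")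
      case False
      then obtain i where i: "i \<in> I" by blast
      have "A i \<noteq> {}" using hall[of "{i}"] i by auto
      then obtain x where x: "x \<in> A i" by blast
      have "\<exists>g. inj_on g (I - {i}) \<and> (\<forall>j\<in>I - {i}. g j \<in> A j - {x})"
      proof (rule less.hyps)
        show "card (I - {i}) < card I" using i fin by (intro psubset_card_mono) auto
        fix K assume K: "K \<subseteq> I - {i}"
        show "card K \<le> card (\<Union>j\<in>K. A j - {x})"
        proof (cases "K = {}")
          case False
          let ?V = "\<Union>j\<in>K. A j"
          have KI: "K \<subset> I" using K i by blast
          \<comment> \<open>No proper nonempty subset is critical, so the union over
            \<open>K\<close> has an element to spare, which pays for the loss of
            \<open>x\<close>.\<close>
          have "card ?V \<noteq> card K" using \<open>\<not> (\<exists>J. _ J)\<close> KI False by blast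
          then have "card K < card ?V" using hall[of K] KI by auto
          moreover have "card ?V - 1 \<le> card (?V - {x})"
            by (cases "x \<in> ?V") (simp_all add: card_Diff_singleton)
          moreover have "(\<Union>j\<in>K. A j - {x}) = ?V - {x}" by auto
          ultimately show ?thesis by simp
        qed simp
      qed (use fin in auto)
      then obtain g where g: "inj_on g (I - {i})" "\<forall>j\<in>I - {i}. g j \<in> A j - {x}" by blast
      have "inj_on (g(i := x)) I"
        using g by (auto simp: inj_on_def)
      moreover have "\<forall>j\<in>I. (g(i := x)) j \<in> A j" using g x by auto
      ultimately show ?thesis by blast
    qed simp
  qed
qed


section \<open>Downward triangles with all neighbours in a given set\<close>

fun corners :: "point \<Rightarrow> point set" where
  "corners (y1, y2, y3) = {(y1 + 1, y2, y3), (y1, y2 + 1, y3), (y1, y2, y3 + 1)}"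

lemma adjacent_iff_corners: "adjacent x y \<longleftrightarrow> x \<in> corners y"
  by (cases y) auto

lemma finite_corners: "finite (corners y)"
  by (cases y) simp

lemma coord_sum_corners: "x \<in> corners y \<Longrightarrow> coord_sum x = coord_sum y + 1"
  by (cases y) auto

lemma ex_other_corner: "\<exists>q\<in>corners y. q \<noteq> p"
  by (cases y) auto

text \<open>For \<open>N \<subseteq> points n\<close> these are the downward triangles enclosed by
  \<open>N\<close>; in particular \<open>inner (points n)\<close> is the set of all downward
  triangles of T(n).\<close>

definition inner :: "point set \<Rightarrow> point set" where
  "inner N = {y. corners y \<subseteq> N}"

lemma finite_inner:
  assumes "finite N" shows "finite (inner N)"
proof -
  \<comment> \<open>A point \<open>y\<close> is recovered from its first corner by lowering the
    first coordinate.\<close>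
  have "inner N \<subseteq> (\<lambda>(x1, x2, x3). (x1 - 1, x2, x3)) ` N"
  proof
    fix y assume "y \<in> inner N"
    then show "y \<in> (\<lambda>(x1, x2, x3). (x1 - 1, x2, x3)) ` N"
      by (cases y) (auto simp: inner_def intro!: image_eqI[of _ _ "(Suc (fst y), snd y)"])
  qed
  then show ?thesis using assms finite_surj by blast
qed

lemma inner_points: "inner (points n) = {y. coord_sum y + 2 = n}"
  by (auto simp: inner_def points_def)

lemma inner_simplex_at: "y \<in> inner (simplex_at n a) \<longleftrightarrow> coord_sum y + 2 = n \<and> below a y"
  by (cases a; cases y) (auto simp: inner_def simplex_at_def points_def)

lemma finite_simplex_at: "finite (simplex_at n a)"
  using finite_points by (simp add: simplex_at_def)

text \<open>
  The downward triangle \<open>y\<close> is matched with \<open>y + e\<^sub>1\<close>; this misses exactly the bottom row \<open>x\<^sub>1 = a\<^sub>1\<close>.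
\<close>
lemma card_simplex_at:
  assumes "coord_sum a + k = n"
  shows "card (simplex_at n a) = card (inner (simplex_at n a)) + k"
proof -
  obtain a1 a2 a3 where a: "a = (a1, a2, a3)" by (cases a)
  let ?up = "\<lambda>(y1, y2, y3). (Suc y1, y2, y3) :: point"
  \<comment> \<open>The last offset is \<open>k - 1 - t\<close> because members of
    \<open>points n\<close> have coordinate sum \<open>n - 1\<close>.\<close>
  let ?row = "\<lambda>t. (a1, a2 + t, a3 + (k - 1 - t)) :: point"
  have eq: "simplex_at n a = ?up ` inner (simplex_at n a) \<union> ?row ` {..<k}"
  proof (intro equalityI subsetI)
    fix x assume x: "x \<in> simplex_at n a"
    obtain x1 x2 x3 where x': "x = (x1, x2, x3)" by (cases x)
    show "x \<in> ?up ` inner (simplex_at n a) \<union> ?row ` {..<k}"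
    proof (cases "x1 = a1")
      case True
      then have "x = ?row (x2 - a2)" "x2 - a2 < k"
        using x assms by (auto simp: x' a simplex_at_def points_def)
      then show ?thesis by blast
    next
      case False
      then have "(x1 - 1, x2, x3) \<in> inner (simplex_at n a)" "x = ?up (x1 - 1, x2, x3)"
        using x unfolding inner_simplex_at by (auto simp: x' a simplex_at_def points_def)
      then show ?thesis by blast
    qed
  next
    fix x assume "x \<in> ?up ` inner (simplex_at n a) \<union> ?row ` {..<k}"
    then show "x \<in> simplex_at n a"
      using assms by (auto simp: inner_simplex_at a) (auto simp: simplex_at_def points_def)
  qed
  have "card (simplex_at n a) = card (?up ` inner (simplex_at n a)) + card (?row ` {..<k})"
    by (subst (1) eq, rule card_Un_disjoint)
      (auto simp: finite_inner finite_simplex_at inner_simplex_at a)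
  moreover have "card (?up ` inner (simplex_at n a)) = card (inner (simplex_at n a))"
    by (rule card_image) (auto simp: inj_on_def)
  moreover have "card (?row ` {..<k}) = k"
    by (subst card_image) (auto simp: inj_on_def)
  ultimately show ?thesis by simp
qed


section \<open>Sets closed under completing corners\<close>

definition corner_closed :: "point set \<Rightarrow> bool" where
  "corner_closed N \<longleftrightarrow> (\<forall>y. \<forall>p\<in>corners y. corners y - {p} \<subseteq> N \<longrightarrow> p \<in> N)"

lemma corner_closedD:
  assumes "corner_closed N" "p \<in> corners y" "q \<in> corners y" "p \<noteq> q" "p \<in> N" "q \<in> N"
  shows "y \<in> inner N"
proof -
  have "r \<in> N" if "r \<in> corners y" for r
    using assms that by (cases y) (fastforce simp: corner_closed_def)
  then show ?thesis by (auto simp: inner_def)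
qed

text \<open>The steps are equivalences, so membership spreads from \<open>s\<close> in both
  directions.\<close>

lemma propagate_along:
  fixes k :: nat
  assumes step: "\<And>t. t < k \<Longrightarrow> f t \<in> N \<longleftrightarrow> f (Suc t) \<in> N"
    and "s \<le> k" "f s \<in> N" "t \<le> k"
  shows "f t \<in> N"
proof -
  have "f t \<in> N \<longleftrightarrow> f 0 \<in> N" if "t \<le> k" for t
    using that by (induction t) (use step in auto)
  then show ?thesis using assms by blast
qed

text \<open>The straddling triangle \<open>y\<close> lies just across one side of the simplex and
  puts one point of the adjacent outer row into \<open>N\<close>. Corner closure fills that row, and
  lowering one coordinate of \<open>a\<close> by one gives \<open>b\<close>.\<close>

lemma simplex_grows:
  assumes N: "corner_closed N" and X: "simplex_at n a \<subseteq> N"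
    and y: "y \<in> inner N" "coord_sum y + 2 = n"
    and q: "q \<in> corners y" "q \<in> simplex_at n a"
    and p: "p \<in> corners y" "p \<notin> simplex_at n a"
  shows "\<exists>b. coord_sum b < coord_sum a \<and> simplex_at n b \<subseteq> N"
proof -
  obtain a1 a2 a3 where a: "a = (a1, a2, a3)" by (cases a)
  obtain y1 y2 y3 where y': "y = (y1, y2, y3)" by (cases y)
  define k where "k = n - coord_sum a"
  have k: "a1 + a2 + a3 + k = n"
    using simplex_at_nonempty[OF q(2)] by (simp add: k_def a)
  have in_X: "(x1, x2, x3) \<in> N"
    if "a1 \<le> x1" "a2 \<le> x2" "a3 \<le> x3" "x1 + x2 + x3 + 1 = n" for x1 x2 x3
    using X that by (auto simp: a simplex_at_def points_def)
  have corner: "u \<in> N \<longleftrightarrow> v \<in> N"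
    if "u \<in> corners z" "v \<in> corners z" "w \<in> corners z" "w \<in> N" "w \<noteq> u" "w \<noteq> v" for u v w z
  proof -
    have "u \<in> N \<or> v \<in> N \<Longrightarrow> corners z \<subseteq> N"
      using corner_closedD[OF N, of w z] that unfolding inner_def by blast
    then show ?thesis using that by blast
  qed
  have y_N: "(Suc y1, y2, y3) \<in> N" "(y1, Suc y2, y3) \<in> N" "(y1, y2, Suc y3) \<in> N"
    using y by (auto simp: inner_def y')
  \<comment> \<open>If \<open>y\<close> were above \<open>a\<close>, all its corners would be
    inside; if it fell short in two coordinates, or by two in one, none would be. So exactly one
    coordinate is short, by one.\<close>
  have "(Suc y1 = a1 \<and> a2 \<le> y2 \<and> a3 \<le> y3) \<or> (a1 \<le> y1 \<and> Suc y2 = a2 \<and> a3 \<le> y3) \<or>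
        (a1 \<le> y1 \<and> a2 \<le> y2 \<and> Suc y3 = a3)"
    using p q y(2) by (auto simp: a y' simplex_at_def points_def)
  then consider (1) "Suc y1 = a1" "a2 \<le> y2" "a3 \<le> y3" | (2) "a1 \<le> y1" "Suc y2 = a2" "a3 \<le> y3"
    | (3) "a1 \<le> y1" "a2 \<le> y2" "Suc y3 = a3" by blast
  then show ?thesis
  proof cases
    case 1
    \<comment> \<open>The outer row along the side \<open>x1 = a1\<close>: it has
      \<open>k + 1\<close> points, one more than that side.\<close>
    let ?f = "\<lambda>t. (y1, a2 + t, a3 + (k - t)) :: point"
    have line: "?f t \<in> N" if "t \<le> k" for t
    proof (rule propagate_along[where f = ?f and k = k and s = "y2 - a2"])
      fix t assume t: "t < k"
      show "?f t \<in> N \<longleftrightarrow> ?f (Suc t) \<in> N"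
        \<comment> \<open>The downward triangle with corners \<open>?f t\<close> and
          \<open>?f (Suc t)\<close> has its third corner on the side of the simplex, hence in
          \<open>N\<close>.\<close>
        by (rule corner[of _ "(y1, a2 + t, a3 + (k - Suc t))" _ "(a1, a2 + t, a3 + (k - Suc t))"])
          (use 1 t k in \<open>auto intro!: in_X\<close>)
    next
      have "?f (y2 - a2) = (y1, y2, Suc y3)" using 1 y(2) k by (auto simp: y')
      then show "?f (y2 - a2) \<in> N" using y_N by (simp only:)
    qed (use 1 y(2) k that in \<open>auto simp: y'\<close>)
    have "simplex_at n (y1, a2, a3) \<subseteq> N"
    proof
      fix x assume x: "x \<in> simplex_at n (y1, a2, a3)"
      obtain x1 x2 x3 where x': "x = (x1, x2, x3)" by (cases x)
      show "x \<in> N"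
      proof (cases "x1 = y1")
        case True
        then have "x = ?f (x2 - a2)" "x2 - a2 \<le> k"
          using x 1 k by (auto simp: x' simplex_at_def points_def)
        then show ?thesis using line by metis
      qed (use x 1 in \<open>auto simp: x' simplex_at_def points_def intro!: in_X\<close>)
    qed
    then show ?thesis using 1 by (intro exI[of _ "(y1, a2, a3)"]) (simp add: a)
  next
    \<comment> \<open>The other two sides are handled alike, with the coordinates permuted.\<close>
    case 2
    let ?f = "\<lambda>t. (a1 + t, y2, a3 + (k - t)) :: point"
    have line: "?f t \<in> N" if "t \<le> k" for t
    proof (rule propagate_along[where f = ?f and k = k and s = "y1 - a1"])
      fix t assume t: "t < k"
      show "?f t \<in> N \<longleftrightarrow> ?f (Suc t) \<in> N"
        by (rule corner[of _ "(a1 + t, y2, a3 + (k - Suc t))" _ "(a1 + t, a2, a3 + (k - Suc t))"])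
          (use 2 t k in \<open>auto intro!: in_X\<close>)
    next
      have "?f (y1 - a1) = (y1, y2, Suc y3)" using 2 y(2) k by (auto simp: y')
      then show "?f (y1 - a1) \<in> N" using y_N by (simp only:)
    qed (use 2 y(2) k that in \<open>auto simp: y'\<close>)
    have "simplex_at n (a1, y2, a3) \<subseteq> N"
    proof
      fix x assume x: "x \<in> simplex_at n (a1, y2, a3)"
      obtain x1 x2 x3 where x': "x = (x1, x2, x3)" by (cases x)
      show "x \<in> N"
      proof (cases "x2 = y2")
        case True
        then have "x = ?f (x1 - a1)" "x1 - a1 \<le> k"
          using x 2 k by (auto simp: x' simplex_at_def points_def)
        then show ?thesis using line by metis
      qed (use x 2 in \<open>auto simp: x' simplex_at_def points_def intro!: in_X\<close>)
    qed
    then show ?thesis using 2 by (intro exI[of _ "(a1, y2, a3)"]) (simp add: a)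
  next
    case 3
    let ?f = "\<lambda>t. (a1 + t, a2 + (k - t), y3) :: point"
    have line: "?f t \<in> N" if "t \<le> k" for t
    proof (rule propagate_along[where f = ?f and k = k and s = "y1 - a1"])
      fix t assume t: "t < k"
      show "?f t \<in> N \<longleftrightarrow> ?f (Suc t) \<in> N"
        by (rule corner[of _ "(a1 + t, a2 + (k - Suc t), y3)" _ "(a1 + t, a2 + (k - Suc t), a3)"])
          (use 3 t k in \<open>auto intro!: in_X\<close>)
    next
      have "?f (y1 - a1) = (y1, Suc y2, y3)" using 3 y(2) k by (auto simp: y')
      then show "?f (y1 - a1) \<in> N" using y_N by (simp only:)
    qed (use 3 y(2) k that in \<open>auto simp: y'\<close>)
    have "simplex_at n (a1, a2, y3) \<subseteq> N"
    proof
      fix x assume x: "x \<in> simplex_at n (a1, a2, y3)"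
      obtain x1 x2 x3 where x': "x = (x1, x2, x3)" by (cases x)
      show "x \<in> N"
      proof (cases "x3 = y3")
        case True
        then have "x = ?f (x1 - a1)" "x1 - a1 \<le> k"
          using x 3 k by (auto simp: x' simplex_at_def points_def)
        then show ?thesis using line by metis
      qed (use x 3 in \<open>auto simp: x' simplex_at_def points_def intro!: in_X\<close>)
    qed
    then show ?thesis using 3 by (intro exI[of _ "(a1, a2, y3)"]) (simp add: a)
  qed
qed

text \<open>Take a largest simplex inside \<open>N\<close>, that is, one with minimal
  \<open>coord_sum a\<close>. A downward triangle straddling its boundary would make it
  grow.\<close>

lemma separated_simplex:
  assumes N: "corner_closed N" "N \<subseteq> points n" "N \<noteq> {}"
  obtains a where "coord_sum a < n" "simplex_at n a \<subseteq> N" "simplex_at n a \<noteq> {}"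
    "\<And>y. y \<in> inner N \<Longrightarrow> corners y \<subseteq> simplex_at n a \<or> corners y \<inter> simplex_at n a = {}"
proof -
  let ?P = "\<lambda>a. coord_sum a < n \<and> simplex_at n a \<subseteq> N"
  obtain x where x: "x \<in> N" using N by blast
  \<comment> \<open>A single point of \<open>N\<close> is a simplex of size 1, so the minimum ranges
    over a nonempty set.\<close>
  have "simplex_at n x \<subseteq> {x}"
    using x N below_coord_sum_eq[of x] by (fastforce simp: simplex_at_def points_def)
  then have Px: "?P x" using x N by (auto simp: points_def)
  define a where "a = (ARG_MIN coord_sum a. ?P a)"
  have a: "?P a"
    unfolding a_def using arg_min_natI[where P = ?P and m = coord_sum, OF Px] .
  have min: "coord_sum a \<le> coord_sum b" if "?P b" for b
    unfolding a_def using arg_min_nat_le[where P = ?P and m = coord_sum, OF that] .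
  show ?thesis
  proof (rule that)
    show "coord_sum a < n" "simplex_at n a \<subseteq> N" using a by blast+
    show "simplex_at n a \<noteq> {}"
      using a card_simplex_at[of a "n - coord_sum a" n] by auto
    fix y assume y: "y \<in> inner N"
    then have "y \<in> inner (points n)" using N by (auto simp: inner_def)
    then have sum_y: "coord_sum y + 2 = n" by (simp add: inner_points)
    show "corners y \<subseteq> simplex_at n a \<or> corners y \<inter> simplex_at n a = {}"
    proof (rule ccontr)
      assume "\<not> ?thesis"
      then obtain p q where "q \<in> corners y" "q \<in> simplex_at n a"
        "p \<in> corners y" "p \<notin> simplex_at n a" by blast
      then obtain b where "coord_sum b < coord_sum a" "simplex_at n b \<subseteq> N"
        using simplex_grows[OF N(1) _ y sum_y] a by blast
      then show False using min[of b] a by simp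
    qed
  qed
qed

section \<open>Holes and enclosed downward triangles of a set of points\<close>

lemma indep_inner_bound_closed:
  assumes "indep n S" "corner_closed N" "N \<subseteq> points n"
  shows "card (N \<inter> S) + card (inner N) \<le> card N"
  using assms(2,3)
proof (induction "card N" arbitrary: N rule: less_induct)
  case less
  show ?case
  proof (cases "N = {}")
    case True
    then have "inner N = {}" using ex_other_corner by (fastforce simp: inner_def)
    then show ?thesis using True by simp
  next
    case False
    have finN: "finite N" using less.prems finite_points finite_subset by blast
    obtain a where a: "coord_sum a < n" "simplex_at n a \<subseteq> N" "simplex_at n a \<noteq> {}"
      and sep: "\<And>y. y \<in> inner N \<Longrightarrow>
        corners y \<subseteq> simplex_at n a \<or> corners y \<inter> simplex_at n a = {}"
      using separated_simplex[OF less.prems False] by blast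
    let ?X = "simplex_at n a" and ?M = "N - simplex_at n a"
    \<comment> \<open>A simplex of size k has at most k holes, and k is its excess of points over
      enclosed downward triangles.\<close>
    have X: "card (?X \<inter> S) + card (inner ?X) \<le> card ?X"
      using card_simplex_at[of a "n - coord_sum a" n] indep_simplex[OF assms(1) a(1)] a(1) by simp
    have "card ?M < card N" using a finN by (intro psubset_card_mono) auto
    \<comment> \<open>The missing corner lies in \<open>N\<close> by closure of \<open>N\<close>; it
      cannot lie in \<open>?X\<close>, since the triangle would then straddle its boundary.\<close>
    moreover have "corner_closed ?M"
      unfolding corner_closed_def
    proof (intro allI ballI impI)
      fix y p assume p: "p \<in> corners y" "corners y - {p} \<subseteq> ?M"
      then have "p \<in> N" using less.prems(1) unfolding corner_closed_def by blast
      then have "y \<in> inner N" using p by (auto simp: inner_def)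
      moreover obtain q where "q \<in> corners y" "q \<noteq> p" using ex_other_corner by blast
      ultimately show "p \<in> ?M" using sep[of y] p \<open>p \<in> N\<close> by blast
    qed
    ultimately have M: "card (?M \<inter> S) + card (inner ?M) \<le> card ?M"
      using less.prems(2) by (intro less.hyps) auto
    \<comment> \<open>No enclosed triangle straddles \<open>?X\<close>, so cutting it out destroys
      none and the bounds add up.\<close>
    have "inner N = inner ?X \<union> inner ?M"
      using sep a(2) by (auto simp: inner_def)
    then have "card (inner N) \<le> card (inner ?X) + card (inner ?M)"
      by (simp add: card_Un_le)
    moreover have "card (N \<inter> S) \<le> card (?X \<inter> S) + card (?M \<inter> S)"
      using card_Un_le[of "?X \<inter> S" "?M \<inter> S"] a(2) by (simp add: Int_Un_distrib2[symmetric] Un_absorb1)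
    moreover have "card N = card ?X + card ?M"
      using card_Un_disjoint[of ?X ?M] a(2) finN finite_simplex_at by (simp add: Un_absorb1)
    ultimately show ?thesis using X M by simp
  qed
qed

text \<open>Adding a missing third corner raises \<open>card N\<close> by one,
  \<open>card (inner N)\<close> by at least one, and loses no hole, so the bound for the larger set
  implies that for \<open>N\<close>. The process stops inside the finite set
  \<open>points n\<close>.\<close>

lemma indep_inner_bound:
  assumes "indep n S" "N \<subseteq> points n"
  shows "card (N \<inter> S) + card (inner N) \<le> card N"
  using assms(2)
proof (induction "card (points n - N)" arbitrary: N rule: less_induct)
  case less
  show ?case
  proof (cases "corner_closed N")
    case True
    then show ?thesis using indep_inner_bound_closed[OF assms(1)] less.prems by blast
  next
    case False
    then obtain y p where p: "p \<in> corners y" "corners y - {p} \<subseteq> N" "p \<notin> N"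
      unfolding corner_closed_def by blast
    have finN: "finite N" using less.prems finite_points finite_subset by blast
    obtain q where q: "q \<in> corners y" "q \<noteq> p" using ex_other_corner by blast
    then have "q \<in> points n" using p less.prems by blast
    then have pn: "p \<in> points n"
      using coord_sum_corners[OF p(1)] coord_sum_corners[OF q(1)] by (simp add: points_def)
    let ?M = "insert p N"
    have "card (points n - ?M) < card (points n - N)"
      using pn p finite_points by (intro psubset_card_mono) auto
    then have M: "card (?M \<inter> S) + card (inner ?M) \<le> card ?M"
      using pn less.prems by (intro less.hyps) auto
    have "inner N \<subset> inner ?M" using p by (auto simp: inner_def)
    then have "card (inner N) < card (inner ?M)"
      using finN by (intro psubset_card_mono finite_inner) auto
    moreover have "card (N \<inter> S) \<le> card (?M \<inter> S)"
      using finN by (intro card_mono) auto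
    ultimately show ?thesis using M finN p(3) by simp
  qed
qed


section \<open>Tilings as matchings\<close>

text \<open>\<open>f y\<close> is the upward triangle that shares a rhombus with the downward
  triangle \<open>y\<close>; \<open>P\<close> is the set of holes.\<close>

definition matching :: "nat \<Rightarrow> point set \<Rightarrow> (point \<Rightarrow> point) \<Rightarrow> bool" where
  "matching n P f \<longleftrightarrow> inj_on f (inner (points n)) \<and> (\<forall>y\<in>inner (points n). f y \<in> corners y - P)"

text \<open>Hall's condition: \<open>J\<close> is enclosed by its neighbourhood \<open>?N\<close>,
  and the bound leaves at least \<open>card (inner ?N)\<close> points of \<open>?N\<close> that are
  not holes.\<close>

lemma matching_if_indep:
  assumes "indep n P"
  shows "\<exists>f. matching n P f"
  unfolding matching_def
proof (rule hall_marriage)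
  show "finite (inner (points n))" by (intro finite_inner finite_points)
  show "finite (corners y - P)" for y by (simp add: finite_corners)
  fix J assume J: "J \<subseteq> inner (points n)"
  let ?N = "\<Union>y\<in>J. corners y"
  have N: "?N \<subseteq> points n" using J by (auto simp: inner_def)
  then have finN: "finite ?N" using finite_points finite_subset by blast
  have "card J \<le> card (inner ?N)"
    using finN by (intro card_mono finite_inner) (auto simp: inner_def)
  also have "\<dots> \<le> card ?N - card (?N \<inter> P)"
    using indep_inner_bound[OF assms N] by simp
  also have "\<dots> = card (?N - P)"
    using finN by (subst card_Diff_subset_Int) auto
  also have "?N - P = (\<Union>y\<in>J. corners y - P)" by blast
  finally show "card J \<le> card (\<Union>y\<in>J. corners y - P)" .
qed

text \<open>The downward triangles enclosed by a simplex use up distinct points of it outside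
  \<open>P\<close>, so only its excess is left for holes.\<close>

lemma indep_if_matching:
  assumes f: "matching n P f" and P: "P \<subseteq> points n"
  shows "indep n P"
  unfolding indep_alt
proof (intro conjI P allI impI)
  fix a assume a: "coord_sum a < n"
  let ?X = "simplex_at n a"
  have sub: "inner ?X \<subseteq> inner (points n)" by (auto simp: inner_def simplex_at_def)
  have "card (inner ?X) = card (f ` inner ?X)"
    using f sub by (intro card_image[symmetric]) (auto simp: matching_def intro: inj_on_subset)
  also have "\<dots> \<le> card (?X - P)"
  proof (intro card_mono finite_Diff finite_simplex_at image_subsetI)
    fix y assume y: "y \<in> inner ?X"
    then have "f y \<in> corners y - P" using f sub unfolding matching_def by blast
    then show "f y \<in> ?X - P" using y unfolding inner_def by blast
  qed
  also have "\<dots> = card ?X - card (?X \<inter> P)"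
    using finite_simplex_at by (subst card_Diff_subset_Int) auto
  finally show "card (?X \<inter> P) \<le> n - coord_sum a"
    using card_simplex_at[of a "n - coord_sum a" n] a
      card_mono[OF finite_simplex_at, of "?X \<inter> P" n a] by auto
qed

lemma points_eq_simplex_at: "points n = simplex_at n (0, 0, 0)"
  by (auto simp: simplex_at_def)

lemma Down_in_unit_triangles: "Down y \<in> unit_triangles n \<longleftrightarrow> y \<in> inner (points n)"
  by (auto simp: unit_triangles_def inner_points)

lemma Up_in_unit_triangles: "Up x \<in> unit_triangles n \<longleftrightarrow> x \<in> points n"
  by (auto simp: unit_triangles_def)

lemma upward_triangles_imageE:
  assumes "S \<subseteq> upward_triangles n"
  obtains P where "P \<subseteq> points n" "S = Up ` P"
  using assms by (auto simp: upward_triangles_def subset_image_iff)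

lemma can_be_tiled_iff_matching:
  assumes P: "P \<subseteq> points n" and card_P: "card P = n"
  shows "can_be_tiled n (Up ` P) \<longleftrightarrow> (\<exists>f. matching n P f)"
proof
  assume "can_be_tiled n (Up ` P)"
  then obtain R where "is_tiling n (Up ` P) R" unfolding can_be_tiled_def by blast
  then have rh: "R \<subseteq> rhombi n" and disj: "\<forall>r\<in>R. r \<inter> Up ` P = {}"
    and uniq: "\<forall>t\<in>unit_triangles n - Up ` P. \<exists>!r. r \<in> R \<and> t \<in> r"
    unfolding is_tiling_def by simp_all
  have "\<exists>x. x \<in> corners y \<and> {Up x, Down y} \<in> R" if y: "y \<in> inner (points n)" for y
  proof -
    have "Down y \<in> unit_triangles n - Up ` P" using y by (auto simp: Down_in_unit_triangles)
    then obtain r where r: "r \<in> R" "Down y \<in> r" using uniq by blast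
    then obtain x y' where "r = {Up x, Down y'}" "adjacent x y'"
      using rh by (auto simp: rhombi_def)
    moreover from this r(2) have "y' = y" by simp
    ultimately show ?thesis using r(1) adjacent_iff_corners by blast
  qed
  then obtain f where f: "\<And>y. y \<in> inner (points n) \<Longrightarrow> f y \<in> corners y"
    "\<And>y. y \<in> inner (points n) \<Longrightarrow> {Up (f y), Down y} \<in> R" by metis
  have notP: "f y \<notin> P" if "y \<in> inner (points n)" for y
    using bspec[OF disj f(2)[OF that]] by auto
  have "inj_on f (inner (points n))"
  proof (rule inj_onI)
    fix y z assume yz: "y \<in> inner (points n)" "z \<in> inner (points n)" "f y = f z"
    have "f y \<in> points n" using f(1)[OF yz(1)] yz(1) by (auto simp: inner_def)
    then have "Up (f y) \<in> unit_triangles n - Up ` P"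
      using notP[OF yz(1)] by (auto simp: Up_in_unit_triangles)
    \<comment> \<open>Only one rhombus covers \<open>Up (f y)\<close>, so equal images give equal
      rhombi.\<close>
    from bspec[OF uniq this] have "{Up (f y), Down y} = {Up (f y), Down z}"
      using f(2)[OF yz(1)] f(2)[OF yz(2)] unfolding yz(3) by blast
    then show "y = z" by (auto simp: doubleton_eq_iff)
  qed
  then show "\<exists>f. matching n P f" using f(1) notP unfolding matching_def by blast
next
  assume "\<exists>f. matching n P f"
  then obtain f where inj: "inj_on f (inner (points n))"
    and f: "\<And>y. y \<in> inner (points n) \<Longrightarrow> f y \<in> corners y" "\<And>y. y \<in> inner (points n) \<Longrightarrow> f y \<notin> P"
    unfolding matching_def by blast
  have fp: "f y \<in> points n" if "y \<in> inner (points n)" for y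
    using f(1)[OF that] that unfolding inner_def by blast
  \<comment> \<open>T(n) has \<open>n\<close> more upward than downward triangles; removing the
    \<open>n\<close> holes equalises the counts, so the injection \<open>f\<close> is onto.\<close>
  have "card (f ` inner (points n)) = card (inner (points n))"
    using inj by (rule card_image)
  also have "\<dots> = card (points n - P)"
    using P card_P finite_points card_simplex_at[of "(0, 0, 0)" n n]
    by (simp add: points_eq_simplex_at[symmetric] card_Diff_subset finite_subset)
  finally have surj: "f ` inner (points n) = points n - P"
    using f(2) fp finite_points by (intro card_subset_eq finite_Diff) blast+
  let ?R = "(\<lambda>y. {Up (f y), Down y}) ` inner (points n)"
  have "is_tiling n (Up ` P) ?R"
    unfolding is_tiling_def
  proof (intro conjI ballI)
    show "?R \<subseteq> rhombi n"
      using f(1) fp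
      unfolding rhombi_def Down_in_unit_triangles Up_in_unit_triangles adjacent_iff_corners
      by blast
    show "r \<inter> Up ` P = {}" if "r \<in> ?R" for r using that f(2) by blast
    fix t assume t: "t \<in> unit_triangles n - Up ` P"
    show "\<exists>!r. r \<in> ?R \<and> t \<in> r"
    proof (cases t)
      case (Up x)
      then have "x \<in> points n - P" using t by (auto simp: Up_in_unit_triangles)
      then obtain y where "y \<in> inner (points n)" "x = f y" using surj by blast
      then show ?thesis
        using Up inj by (intro ex1I[of _ "{Up (f y), Down y}"]) (auto dest: inj_onD)
    next
      case (Down y)
      then show ?thesis using t by (auto simp: Down_in_unit_triangles)
    qed
  qed
  then show "can_be_tiled n (Up ` P)" unfolding can_be_tiled_def by blast
qed

section \<open>Bases and subtriangles as forms of independence\<close>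

lemma basis_iff_indep:
  assumes "n \<ge> 1" "card P = n"
  shows "matroid.basis (indep n) P \<longleftrightarrow> indep n P"
proof -
  have "B = P" if "indep n B" "P \<subseteq> B" for B
  proof -
    have B: "B \<subseteq> points n" using that by (simp add: indep_def)
    then have "points n \<inter> B = B" by blast
    \<comment> \<open>All of T(n) is a simplex of size \<open>n\<close>, so an independent set with
      \<open>n\<close> points is already maximal.\<close>
    then have "card B \<le> n"
      using indep_simplex[OF that(1), of "(0, 0, 0)"] assms
      by (simp add: points_eq_simplex_at[symmetric])
    moreover have "finite B" using B finite_points finite_subset by blast
    ultimately show ?thesis using that assms card_seteq[of B P] by simp
  qed
  then show ?thesis
    unfolding matroid.basis_def[OF matroid_points] by blast
qed

lemma indep_iff_subtriangles:
  assumes "P \<subseteq> points n"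
  shows "indep n P \<longleftrightarrow>
    (\<forall>k T. 1 \<le> k \<and> k \<le> n \<and> is_subtriangle n k T \<longrightarrow> card (T \<inter> Up ` P) \<le> k)"
proof -
  define tri where
    "tri a = {t \<in> unit_triangles n. case t of Up x \<Rightarrow> below a x | Down y \<Rightarrow> below a y}" for a
  \<comment> \<open>All holes point upward, so the downward triangles of \<open>tri a\<close> do not
    affect the count.\<close>
  have "tri a \<inter> Up ` P = Up ` (simplex_at n a \<inter> P)" for a
    using assms by (auto simp: tri_def Up_in_unit_triangles simplex_at_def)
  then have card_tri: "card (tri a \<inter> Up ` P) = card (simplex_at n a \<inter> P)" for a
    by (simp add: card_image inj_on_def)
  have "is_subtriangle n k T \<longleftrightarrow> (\<exists>a. coord_sum a + k = n \<and> T = tri a)" for k T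
    by (simp only: is_subtriangle_def tri_def)
  moreover have "is_simplex n k X \<longleftrightarrow> (\<exists>a. coord_sum a + k = n \<and> X = simplex_at n a)" for k X
    by (simp only: is_simplex_def simplex_at_def)
  ultimately show ?thesis
    using assms card_tri unfolding indep_def by metis
qed

theorem theorem6p2:
  fixes n :: nat and S :: "unit_triangle set"
  assumes "n \<ge> 1"
    and "S \<subseteq> upward_triangles n"
    and "card S = n"
  shows "(can_be_tiled n S \<longleftrightarrow> matroid.basis (indep n) (locations S)) \<and>
         (can_be_tiled n S \<longleftrightarrow>
            (\<forall>k T. 1 \<le> k \<and> k \<le> n \<and> is_subtriangle n k T \<longrightarrow> card (T \<inter> S) \<le> k))"
proof -
  obtain P where P: "P \<subseteq> points n" and S: "S = Up ` P"
    using upward_triangles_imageE[OF assms(2)] by blast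
  have card_P: "card P = n" using assms(3) by (simp add: S card_image inj_on_def)
  have "locations S = P" by (auto simp: S locations_def)
  moreover have "can_be_tiled n S \<longleftrightarrow> indep n P"
    using can_be_tiled_iff_matching[OF P card_P] matching_if_indep indep_if_matching[OF _ P]
    unfolding S by blast
  ultimately show ?thesis
    using basis_iff_indep[OF assms(1) card_P] indep_iff_subtriangles[OF P] unfolding S by simp
qed

end
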